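(* Let $\mathcal{S}=\langle\mathcal{L},\vdash\rangle$ be a monotonic logic. If $\mathcal{S}$ is NF-paraconsistent, then there does not exist any $\varphi\in\mathcal{L}$ such that $C_\vdash(\{\varphi\})=\mathcal{L}$.
   Context: A logic is a pair $\mathcal{S}=\langle\mathcal{L},\vdash\rangle$ where $\mathcal{L}$ is an arbitrary set and $\vdash\,\subseteq\mathcal{P}(\mathcal{L})\times\mathcal{L}$. For $\Gamma\subseteq\mathcal{L}$, $C_\vdash(\Gamma)=\{\alpha\in\mathcal{L}:\Gamma\vdash\alpha\}$. $\mathcal{S}$ is monotonic if $\Gamma\subseteq\Sigma\subseteq\mathcal{L}$ implies $C_\vdash(\Gamma)\subseteq C_\vdash(\Sigma)$. The principle gECQ says: for each $\alpha\in\mathcal{L}$ there exists $\beta\in\mathcal{L}$ with $C_\vdash(\{\alpha,\beta\})=\mathcal{L}$. $\mathcal{S}$ is NF-paraconsistent if gECQ fails, i.e., there exists $\alpha\in\mathcal{L}$ such that $C_\vdash(\{\alpha,\beta\})\neq\mathcal{L}$ for every $\beta\in\mathcal{L}$. *)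

theory Defs
  imports Main
begin

(* A logic is a carrier set L of formulas (any set, possibly empty) together with a
   relation between subsets of L and elements of L. *)
definition is_logic :: "'a set \<Rightarrow> ('a set \<times> 'a) set \<Rightarrow> bool" where
  "is_logic L ent \<longleftrightarrow> ent \<subseteq> Pow L \<times> L"

definition Cn :: "'a set \<Rightarrow> ('a set \<times> 'a) set \<Rightarrow> 'a set \<Rightarrow> 'a set" where
  "Cn L ent \<Gamma> = {\<alpha> \<in> L. (\<Gamma>, \<alpha>) \<in> ent}"

definition monotonic :: "'a set \<Rightarrow> ('a set \<times> 'a) set \<Rightarrow> bool" where
  "monotonic L ent \<longleftrightarrow>
     (\<forall>\<Gamma> \<Sigma>. \<Gamma> \<subseteq> \<Sigma> \<and> \<Sigma> \<subseteq> L \<longrightarrow> Cn L ent \<Gamma> \<subseteq> Cn L ent \<Sigma>)"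

definition gECQ :: "'a set \<Rightarrow> ('a set \<times> 'a) set \<Rightarrow> bool" where
  "gECQ L ent \<longleftrightarrow> (\<forall>\<alpha>\<in>L. \<exists>\<beta>\<in>L. Cn L ent {\<alpha>, \<beta>} = L)"

definition NF_paraconsistent :: "'a set \<Rightarrow> ('a set \<times> 'a) set \<Rightarrow> bool" where
  "NF_paraconsistent L ent \<longleftrightarrow> \<not> gECQ L ent"

end

theory Submission
  imports Defs
begin

text \<open>By contraposition: a formula \<phi> that explodes on its own still explodes, by
  monotonicity, in the company of any \<alpha>. So this single \<phi> serves as the witness \<beta>
  in \<open>gECQ\<close> for every \<alpha> at once.\<close>

theorem theorem2p3:
  fixes L :: "'a set" and ent :: "('a set \<times> 'a) set"
  assumes "is_logic L ent"
    and "monotonic L ent"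
    and "NF_paraconsistent L ent"
  shows "\<not> (\<exists>\<phi>\<in>L. Cn L ent {\<phi>} = L)"
proof
  assume "\<exists>\<phi>\<in>L. Cn L ent {\<phi>} = L"
  then obtain \<phi> where \<phi>: "\<phi> \<in> L" "Cn L ent {\<phi>} = L" by blast
  have "Cn L ent {\<alpha>, \<phi>} = L" if "\<alpha> \<in> L" for \<alpha>
  proof
    show "Cn L ent {\<alpha>, \<phi>} \<subseteq> L" by (auto simp: Cn_def)
    \<comment> \<open>\<open>monotonic\<close> only compares sets whose larger member lies inside
      \<open>L\<close>; this is where \<alpha> \<in> \<open>L\<close> enters.\<close>
    have "{\<phi>} \<subseteq> {\<alpha>, \<phi>}" "{\<alpha>, \<phi>} \<subseteq> L" using that \<phi>(1) by auto
    then have "Cn L ent {\<phi>} \<subseteq> Cn L ent {\<alpha>, \<phi>}"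
      using assms(2) unfolding monotonic_def by blast
    then show "L \<subseteq> Cn L ent {\<alpha>, \<phi>}" using \<phi>(2) by simp
  qed
  then have "gECQ L ent" using \<phi>(1) unfolding gECQ_def by blast
  then show False using assms(3) unfolding NF_paraconsistent_def by simp
qed

end
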